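(* If $S$ and $T$ are strongly Morita equivalent inverse semigroups, then they have isomorphic maximal group images: $G(S)\cong G(T)$.
   Context: An inverse semigroup is a semigroup $S$ such that for each $s\in S$ there is a unique $s^*\in S$ with $ss^*s=s$ and $s^*ss^*=s^*$; $E(S)$ is its set of idempotents; $s\le t$ means $s=et$ for some $e\in E(S)$. The maximal group image $G(S)$ is the quotient of $S$ by the congruence identifying two elements iff they have a common lower bound in $\le$; every homomorphism from $S$ to a group factors through $S\to G(S)$. A Morita context is a 5-tuple $(S,T,X,\langle\ ,\ \rangle,[\ ,\ ])$ where $S,T$ are inverse semigroups, $X$ is a set with a left action of $S$ and a right action of $T$ that commute, and $\langle\ ,\ \rangle\colon X\times X\to S$, $[\ ,\ ]\colon X\times X\to T$ are surjective functions such that for all $x,y,z\in X$, $s\in S$, $t\in T$: (1) $\langle sx,y\rangle=s\langle x,y\rangle$; (2) $\langle y,x\rangle=\langle x,y\rangle^*$; (3) $\langle x,x\rangle x=x$; (4) $[x,yt]=[x,y]t$; (5) $[y,x]=[x,y]^*$; (6) $x[x,x]=x$; (7) $\langle x,y\rangle z=x[y,z]$. $S$ and $T$ are strongly Morita equivalent if such a Morita context exists. *)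

theory Defs
  imports "HOL-Algebra.Group"
begin

section \<open>Inverse semigroups\<close>

record 'a sgrp = "'a partial_object" +
  smult :: "['a, 'a] \<Rightarrow> 'a"  (infixl \<open>\<cdot>\<index>\<close> 70)

locale inverse_semigroup =
  fixes S :: "'a sgrp"  (structure)
  assumes closed: "\<lbrakk>s \<in> carrier S; t \<in> carrier S\<rbrakk> \<Longrightarrow> s \<cdot> t \<in> carrier S"
    and assoc: "\<lbrakk>s \<in> carrier S; t \<in> carrier S; u \<in> carrier S\<rbrakk>
                  \<Longrightarrow> (s \<cdot> t) \<cdot> u = s \<cdot> (t \<cdot> u)"
    and ex1_star: "s \<in> carrier S
                  \<Longrightarrow> \<exists>!t. t \<in> carrier S \<and> s \<cdot> t \<cdot> s = s \<and> t \<cdot> s \<cdot> t = t"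

definition star :: "'a sgrp \<Rightarrow> 'a \<Rightarrow> 'a" where
  "star S s = (THE t. t \<in> carrier S \<and> s \<cdot>\<^bsub>S\<^esub> t \<cdot>\<^bsub>S\<^esub> s = s \<and> t \<cdot>\<^bsub>S\<^esub> s \<cdot>\<^bsub>S\<^esub> t = t)"

definition idems :: "'a sgrp \<Rightarrow> 'a set" where
  "idems S = {e \<in> carrier S. e \<cdot>\<^bsub>S\<^esub> e = e}"

definition nat_le :: "'a sgrp \<Rightarrow> 'a \<Rightarrow> 'a \<Rightarrow> bool" where
  "nat_le S s t \<longleftrightarrow> s \<in> carrier S \<and> t \<in> carrier S \<and> (\<exists>e\<in>idems S. s = e \<cdot>\<^bsub>S\<^esub> t)"

section \<open>The maximal group image\<close>

definition min_group_cong :: "'a sgrp \<Rightarrow> ('a \<times> 'a) set" where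
  "min_group_cong S = {(s, t). s \<in> carrier S \<and> t \<in> carrier S \<and>
     (\<exists>u\<in>carrier S. nat_le S u s \<and> nat_le S u t)}"

text \<open>
  All idempotents lie in a single class, so the image of the set of idempotents under the
  congruence is that class; it is the identity of the quotient. If the carrier of \<open>S\<close> is
  nonempty, the quotient is a group (lemma \<open>group_max_group_image\<close> below).
\<close>

definition max_group_image :: "'a sgrp \<Rightarrow> 'a set monoid" where
  "max_group_image S =
     \<lparr>carrier = carrier S // min_group_cong S,
      mult = (\<lambda>A B. \<Union>a\<in>A. \<Union>b\<in>B. min_group_cong S `` {a \<cdot>\<^bsub>S\<^esub> b}),
      one = min_group_cong S `` idems S\<rparr>"

section \<open>Strong Morita equivalence\<close>

locale morita_context = S: inverse_semigroup S + T: inverse_semigroup T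
  for S :: "'a sgrp" and T :: "'b sgrp" +
  fixes X :: "'x set"
    and lact :: "'a \<Rightarrow> 'x \<Rightarrow> 'x"
    and ract :: "'x \<Rightarrow> 'b \<Rightarrow> 'x"
    and lip :: "'x \<Rightarrow> 'x \<Rightarrow> 'a"
    and rip :: "'x \<Rightarrow> 'x \<Rightarrow> 'b"
  assumes lact_closed: "\<lbrakk>s \<in> carrier S; x \<in> X\<rbrakk> \<Longrightarrow> lact s x \<in> X"
    and lact_mult: "\<lbrakk>s \<in> carrier S; s' \<in> carrier S; x \<in> X\<rbrakk>
                      \<Longrightarrow> lact (s \<cdot>\<^bsub>S\<^esub> s') x = lact s (lact s' x)"
    and ract_closed: "\<lbrakk>x \<in> X; t \<in> carrier T\<rbrakk> \<Longrightarrow> ract x t \<in> X"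
    and ract_mult: "\<lbrakk>x \<in> X; t \<in> carrier T; t' \<in> carrier T\<rbrakk>
                      \<Longrightarrow> ract x (t \<cdot>\<^bsub>T\<^esub> t') = ract (ract x t) t'"
    and lact_ract: "\<lbrakk>s \<in> carrier S; x \<in> X; t \<in> carrier T\<rbrakk>
                      \<Longrightarrow> ract (lact s x) t = lact s (ract x t)"
    and lip_surj: "(\<lambda>(x, y). lip x y) ` (X \<times> X) = carrier S"
    and rip_surj: "(\<lambda>(x, y). rip x y) ` (X \<times> X) = carrier T"
    and lip_lact: "\<lbrakk>s \<in> carrier S; x \<in> X; y \<in> X\<rbrakk> \<Longrightarrow> lip (lact s x) y = s \<cdot>\<^bsub>S\<^esub> lip x y"
    and lip_star: "\<lbrakk>x \<in> X; y \<in> X\<rbrakk> \<Longrightarrow> lip y x = star S (lip x y)"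
    and lip_self: "x \<in> X \<Longrightarrow> lact (lip x x) x = x"
    and rip_ract: "\<lbrakk>x \<in> X; y \<in> X; t \<in> carrier T\<rbrakk> \<Longrightarrow> rip x (ract y t) = rip x y \<cdot>\<^bsub>T\<^esub> t"
    and rip_star: "\<lbrakk>x \<in> X; y \<in> X\<rbrakk> \<Longrightarrow> rip y x = star T (rip x y)"
    and rip_self: "x \<in> X \<Longrightarrow> ract x (rip x x) = x"
    and lip_rip: "\<lbrakk>x \<in> X; y \<in> X; z \<in> X\<rbrakk> \<Longrightarrow> lact (lip x y) z = ract x (rip y z)"

text \<open>
  HOL cannot quantify existentially over types inside a formula, so the ambient type of the
  set \<open>X\<close> is an explicit parameter. A theorem assuming this predicate for a free type variable
  \<open>'x\<close> covers Morita contexts on sets of arbitrary type.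
\<close>

definition strongly_morita_equivalent :: "'x itself \<Rightarrow> 'a sgrp \<Rightarrow> 'b sgrp \<Rightarrow> bool" where
  "strongly_morita_equivalent _ S T \<longleftrightarrow>
     (\<exists>(X :: 'x set) lact ract lip rip. morita_context S T X lact ract lip rip)"

section \<open>The quotient is a group\<close>

context inverse_semigroup
begin

lemma star_unique:
  assumes "s \<in> carrier S" "t \<in> carrier S" "s \<cdot> t \<cdot> s = s" "t \<cdot> s \<cdot> t = t"
  shows "star S s = t"
  unfolding star_def using ex1_star[OF assms(1)] assms by (intro the1_equality) auto

lemma star_props:
  assumes "s \<in> carrier S"
  shows "star S s \<in> carrier S" "s \<cdot> star S s \<cdot> s = s" "star S s \<cdot> s \<cdot> star S s = star S s"
  using theI'[OF ex1_star[OF assms]] unfolding star_def by auto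

lemma idemsD: "e \<in> idems S \<Longrightarrow> e \<in> carrier S" "e \<in> idems S \<Longrightarrow> e \<cdot> e = e"
  by (auto simp: idems_def)

lemma idem_absorb: "\<lbrakk>e \<in> idems S; a \<in> carrier S\<rbrakk> \<Longrightarrow> e \<cdot> (e \<cdot> a) = e \<cdot> a"
  by (metis assoc idemsD)

lemma idem_mult:
  assumes e: "e \<in> idems S" and f: "f \<in> idems S"
  shows "e \<cdot> f \<in> idems S"
proof -
  note c = idemsD(1)[OF e] idemsD(1)[OF f]
  define x where "x = star S (e \<cdot> f)"
  have xc: "x \<in> carrier S" and x1: "e \<cdot> f \<cdot> x \<cdot> (e \<cdot> f) = e \<cdot> f"
    and x2: "x \<cdot> (e \<cdot> f) \<cdot> x = x"
    using star_props[OF closed[OF c]] unfolding x_def by auto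
  note cl = c xc closed
  have x1': "e \<cdot> (f \<cdot> (x \<cdot> (e \<cdot> f))) = e \<cdot> f" using x1 by (simp add: cl assoc)
  have x2': "x \<cdot> (e \<cdot> (f \<cdot> (x \<cdot> e))) = x \<cdot> e"
    using arg_cong[OF x2, of "\<lambda>y. y \<cdot> e"] by (simp add: cl assoc)
  have "star S (e \<cdot> f) = f \<cdot> x \<cdot> e"
    by (rule star_unique)
      (simp_all add: cl assoc idem_absorb[OF e] idem_absorb[OF f] x1' x2')
  then have fx: "f \<cdot> (x \<cdot> e) = x" by (simp add: x_def[symmetric] cl assoc)
  have "x \<cdot> x = f \<cdot> (x \<cdot> e) \<cdot> (f \<cdot> (x \<cdot> e))" by (simp add: fx)
  also have "\<dots> = f \<cdot> (x \<cdot> e)" by (simp add: cl assoc x2')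
  finally have xx: "x \<cdot> x = x" by (simp add: fx)
  have "star S x = x" by (rule star_unique) (simp_all add: xc xx)
  moreover have "star S x = e \<cdot> f"
    by (rule star_unique) (use x1 x2 cl in auto)
  ultimately have "e \<cdot> f = x" by simp
  then show ?thesis using xx xc by (simp add: idems_def)
qed

lemma idem_commute:
  assumes e: "e \<in> idems S" and f: "f \<in> idems S"
  shows "e \<cdot> f = f \<cdot> e"
proof -
  note c = idemsD(1)[OF e] idemsD(1)[OF f] closed
  have ef: "e \<cdot> (f \<cdot> (e \<cdot> f)) = e \<cdot> f" and fe: "f \<cdot> (e \<cdot> (f \<cdot> e)) = f \<cdot> e"
    using idemsD(2)[OF idem_mult[OF e f]] idemsD(2)[OF idem_mult[OF f e]]
    by (simp_all add: c assoc)
  have "star S (e \<cdot> f) = f \<cdot> e"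
    by (rule star_unique)
      (simp_all add: c assoc idem_absorb[OF e] idem_absorb[OF f] ef fe)
  moreover have "star S (e \<cdot> f) = e \<cdot> f"
    by (rule star_unique) (simp_all add: c assoc ef)
  ultimately show ?thesis by simp
qed

lemma star_idem:
  assumes "s \<in> carrier S"
  shows "s \<cdot> star S s \<in> idems S" "star S s \<cdot> s \<in> idems S"
proof -
  note c = assms star_props(1)[OF assms] closed
  have "s \<cdot> star S s \<cdot> (s \<cdot> star S s) = s \<cdot> star S s \<cdot> s \<cdot> star S s"
    "star S s \<cdot> s \<cdot> (star S s \<cdot> s) = star S s \<cdot> s \<cdot> star S s \<cdot> s"
    by (simp_all add: c assoc)
  then show "s \<cdot> star S s \<in> idems S" "star S s \<cdot> s \<in> idems S"
    using star_props(2,3)[OF assms] by (simp_all add: idems_def c)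
qed

lemma mgc_iff:
  "(s, t) \<in> min_group_cong S \<longleftrightarrow>
     s \<in> carrier S \<and> t \<in> carrier S \<and> (\<exists>e\<in>idems S. \<exists>f\<in>idems S. e \<cdot> s = f \<cdot> t)"
proof -
  have "(\<exists>u\<in>carrier S. nat_le S u s \<and> nat_le S u t) \<longleftrightarrow>
          (\<exists>e\<in>idems S. \<exists>f\<in>idems S. e \<cdot> s = f \<cdot> t)"
    if "s \<in> carrier S" "t \<in> carrier S"
    using that closed[OF idemsD(1)] unfolding nat_le_def by blast
  then show ?thesis by (auto simp: min_group_cong_def)
qed

lemma equiv_mgc: "equiv (carrier S) (min_group_cong S)"
proof (rule equivI)
  show "min_group_cong S \<subseteq> carrier S \<times> carrier S" by (auto simp: mgc_iff)
  show "refl_on (carrier S) (min_group_cong S)"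
    unfolding refl_on_def mgc_iff using star_idem(1) by blast
  show "sym (min_group_cong S)" unfolding sym_def mgc_iff by (blast dest: sym)
  show "trans (min_group_cong S)"
  proof (rule transI)
    fix s t r assume "(s, t) \<in> min_group_cong S" "(t, r) \<in> min_group_cong S"
    then obtain e f g h where c: "s \<in> carrier S" "t \<in> carrier S" "r \<in> carrier S"
      and i: "e \<in> idems S" "f \<in> idems S" "g \<in> idems S" "h \<in> idems S"
      and 1: "e \<cdot> s = f \<cdot> t" "g \<cdot> t = h \<cdot> r" by (auto simp: mgc_iff)
    note ic = i[THEN idemsD(1)]
    have "g \<cdot> e \<cdot> s = g \<cdot> f \<cdot> t" using 1 c ic by (simp add: assoc)
    also have "\<dots> = f \<cdot> g \<cdot> t" using idem_commute i by simp
    also have "\<dots> = f \<cdot> h \<cdot> r" using 1 c ic by (simp add: assoc)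
    finally show "(s, r) \<in> min_group_cong S"
      using c i idem_mult by (auto simp: mgc_iff)
  qed
qed

lemma mgc_right:
  assumes "(s, t) \<in> min_group_cong S" "a \<in> carrier S"
  shows "(s \<cdot> a, t \<cdot> a) \<in> min_group_cong S"
proof -
  from assms obtain e f where c: "s \<in> carrier S" "t \<in> carrier S" "e \<in> idems S" "f \<in> idems S"
    and "e \<cdot> s = f \<cdot> t" by (auto simp: mgc_iff)
  then have "e \<cdot> (s \<cdot> a) = f \<cdot> (t \<cdot> a)"
    using assms(2) by (simp add: assoc[symmetric] idemsD(1))
  then show ?thesis unfolding mgc_iff using c assms(2) closed by blast
qed

lemma conj_idem:
  assumes a: "a \<in> carrier S" and e: "e \<in> idems S"
  shows "a \<cdot> e \<cdot> star S a \<in> idems S" "s \<in> carrier S \<Longrightarrow> a \<cdot> e \<cdot> star S a \<cdot> (a \<cdot> s) = a \<cdot> (e \<cdot> s)"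
proof -
  let ?b = "star S a"
  note c = a idemsD(1)[OF e] star_props(1)[OF a] closed
  have k: "e \<cdot> ?b \<cdot> a = ?b \<cdot> a \<cdot> e"
    using idem_commute[OF e star_idem(2)[OF a]] by (simp add: c assoc)
  have ae: "a \<cdot> e \<cdot> ?b \<cdot> a = a \<cdot> e"
  proof -
    have "a \<cdot> e \<cdot> ?b \<cdot> a = a \<cdot> (e \<cdot> ?b \<cdot> a)" by (simp add: c assoc)
    also have "\<dots> = a \<cdot> ?b \<cdot> a \<cdot> e" unfolding k by (simp add: c assoc)
    finally show ?thesis using star_props(2)[OF a] by simp
  qed
  have "a \<cdot> e \<cdot> ?b \<cdot> (a \<cdot> e \<cdot> ?b) = a \<cdot> e \<cdot> ?b \<cdot> a \<cdot> (e \<cdot> ?b)" by (simp add: c assoc)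
  also have "\<dots> = a \<cdot> e \<cdot> ?b" unfolding ae by (simp add: c assoc idem_absorb[OF e])
  finally show "a \<cdot> e \<cdot> ?b \<in> idems S" by (simp add: idems_def c)
  assume s: "s \<in> carrier S"
  have "a \<cdot> e \<cdot> ?b \<cdot> (a \<cdot> s) = a \<cdot> e \<cdot> ?b \<cdot> a \<cdot> s" by (simp add: c s assoc)
  then show "a \<cdot> e \<cdot> ?b \<cdot> (a \<cdot> s) = a \<cdot> (e \<cdot> s)" unfolding ae by (simp add: c s assoc)
qed

lemma mgc_left:
  assumes "(s, t) \<in> min_group_cong S" "a \<in> carrier S"
  shows "(a \<cdot> s, a \<cdot> t) \<in> min_group_cong S"
proof -
  from assms obtain e f where c: "s \<in> carrier S" "t \<in> carrier S" "e \<in> idems S" "f \<in> idems S"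
    and "e \<cdot> s = f \<cdot> t" by (auto simp: mgc_iff)
  then have "a \<cdot> e \<cdot> star S a \<cdot> (a \<cdot> s) = a \<cdot> f \<cdot> star S a \<cdot> (a \<cdot> t)"
    using assms(2) by (simp add: conj_idem(2))
  then show ?thesis unfolding mgc_iff using c assms(2) conj_idem(1) closed by blast
qed

lemma mgc_mult:
  assumes "(s, s') \<in> min_group_cong S" "(t, t') \<in> min_group_cong S"
  shows "(s \<cdot> t, s' \<cdot> t') \<in> min_group_cong S"
proof -
  have "t \<in> carrier S" "s' \<in> carrier S" using assms by (auto simp: mgc_iff)
  then have "(s \<cdot> t, s' \<cdot> t) \<in> min_group_cong S" "(s' \<cdot> t, s' \<cdot> t') \<in> min_group_cong S"
    using mgc_right mgc_left assms by auto
  then show ?thesis using equiv_mgc by (meson equiv_def transD)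
qed

lemma max_group_image_mult_class:
  assumes "s \<in> carrier S" "t \<in> carrier S"
  shows "min_group_cong S `` {s} \<otimes>\<^bsub>max_group_image S\<^esub> min_group_cong S `` {t}
           = min_group_cong S `` {s \<cdot> t}"
proof -
  have "congruent2 (min_group_cong S) (min_group_cong S) (\<lambda>a b. min_group_cong S `` {a \<cdot> b})"
    by (auto simp: congruent2_def intro!: equiv_class_eq[OF equiv_mgc] mgc_mult)
  from UN_equiv_class2[OF equiv_mgc equiv_mgc this assms] show ?thesis
    by (simp add: max_group_image_def)
qed

lemma idem_class:
  assumes "e \<in> idems S"
  shows "\<one>\<^bsub>max_group_image S\<^esub> = min_group_cong S `` {e}"
proof -
  have "min_group_cong S `` {f} = min_group_cong S `` {e}" if f: "f \<in> idems S" for f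
  proof (rule equiv_class_eq[OF equiv_mgc])
    show "(f, e) \<in> min_group_cong S"
      unfolding mgc_iff using f assms idem_commute[OF assms f] idemsD(1) by blast
  qed
  then have "(\<Union>f\<in>idems S. min_group_cong S `` {f}) = min_group_cong S `` {e}"
    using assms by blast
  then show ?thesis by (simp add: max_group_image_def Image_eq_UN[symmetric])
qed

lemma group_max_group_image:
  assumes ne: "carrier S \<noteq> {}"
  shows "group (max_group_image S)"
proof -
  let ?c = "\<lambda>s. min_group_cong S `` {s}" and ?G = "max_group_image S"
  have car: "carrier ?G = ?c ` carrier S"
    by (auto simp: max_group_image_def quotient_def)
  from ne obtain e where e: "e \<in> idems S" using star_idem by blast
  note one = idem_class[OF e] and ec = idemsD(1)[OF e]
  show ?thesis
  proof (rule groupI)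
    fix A B C assume "A \<in> carrier ?G" "B \<in> carrier ?G" "C \<in> carrier ?G"
    then show "A \<otimes>\<^bsub>?G\<^esub> B \<otimes>\<^bsub>?G\<^esub> C = A \<otimes>\<^bsub>?G\<^esub> (B \<otimes>\<^bsub>?G\<^esub> C)"
      by (auto simp: car max_group_image_mult_class closed assoc)
  next
    fix A assume "A \<in> carrier ?G"
    then obtain s where s: "s \<in> carrier S" "A = ?c s" by (auto simp: car)
    have "(e \<cdot> s, s) \<in> min_group_cong S"
      using s e ec idem_absorb by (auto simp: mgc_iff closed)
    then show "\<one>\<^bsub>?G\<^esub> \<otimes>\<^bsub>?G\<^esub> A = A"
      using s ec by (simp add: one max_group_image_mult_class equiv_class_eq[OF equiv_mgc])
    have "?c (star S s) \<otimes>\<^bsub>?G\<^esub> A = \<one>\<^bsub>?G\<^esub>"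
      using s star_props(1) by (simp add: max_group_image_mult_class idem_class[OF star_idem(2)[OF s(1)]])
    then show "\<exists>B\<in>carrier ?G. B \<otimes>\<^bsub>?G\<^esub> A = \<one>\<^bsub>?G\<^esub>"
      using s star_props(1) by (auto simp: car)
  next
    show "\<one>\<^bsub>?G\<^esub> \<in> carrier ?G" using one ec by (auto simp: car)
  next
    fix A B assume "A \<in> carrier ?G" "B \<in> carrier ?G"
    then show "A \<otimes>\<^bsub>?G\<^esub> B \<in> carrier ?G"
      by (auto simp: car max_group_image_mult_class closed)
  qed
qed

end

end

theory Submission
  imports Defs
begin

text \<open>
  Fix \<open>p \<in> X\<close>. The map \<open>s \<mapsto> [p, sp]\<close> sends products to products up to the minimum group
  congruence, because \<open>[p, sp][p, s'p] = [p, s\<langle>p, p\<rangle>s'p]\<close> and inserting an idempotent of \<open>S\<close>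
  multiplies the bracket by an idempotent of \<open>T\<close>. The map \<open>t \<mapsto> \<langle>pt, p\<rangle>\<close> inverts it modulo the
  congruences: \<open>\<langle>p[p, sp], p\<rangle> = \<langle>p, p\<rangle>s\<langle>p, p\<rangle>\<close> and \<open>[p, \<langle>pt, p\<rangle>p] = [p, p]t[p, p]\<close>.
\<close>

context inverse_semigroup
begin

lemma mgc_idem_left:
  assumes "e \<in> idems S" "s \<in> carrier S"
  shows "(e \<cdot> s, s) \<in> min_group_cong S"
  using assms idem_absorb by (auto simp: mgc_iff closed idemsD(1))

text \<open>The idempotent moves to the left by conjugation:
  \<open>s \<cdot> e = (s \<cdot> e \<cdot> star S s) \<cdot> s\<close>, because \<open>e\<close>
  commutes with \<open>star S s \<cdot> s\<close>, and the bracketed factor is again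
  idempotent.\<close>

lemma mgc_idem_right:
  assumes "e \<in> idems S" "s \<in> carrier S"
  shows "(s \<cdot> e, s) \<in> min_group_cong S"
proof -
  have "s \<cdot> e \<cdot> star S s \<cdot> s = s \<cdot> (e \<cdot> (star S s \<cdot> s))"
    using assms by (simp add: assoc closed idemsD(1) star_props(1))
  also have "\<dots> = s \<cdot> (star S s \<cdot> s \<cdot> e)"
    using assms by (simp add: idem_commute star_idem(2))
  also have "\<dots> = s \<cdot> star S s \<cdot> s \<cdot> e"
    using assms by (simp add: assoc closed idemsD(1) star_props(1))
  finally have "s \<cdot> e = s \<cdot> e \<cdot> star S s \<cdot> s"
    using assms by (simp add: star_props(2))
  then show ?thesis
    using mgc_idem_left[OF conj_idem(1)[OF assms(2,1)] assms(2)] by simp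
qed

lemma mgc_sym: "(s, t) \<in> min_group_cong S \<Longrightarrow> (t, s) \<in> min_group_cong S"
  using equiv_mgc by (meson equiv_def symD)

lemma mgc_trans [trans]:
  "\<lbrakk>(s, t) \<in> min_group_cong S; (t, u) \<in> min_group_cong S\<rbrakk> \<Longrightarrow> (s, u) \<in> min_group_cong S"
  using equiv_mgc by (meson equiv_def transD)

text \<open>A first isomorphism theorem: by \<open>ker_h\<close>, the map \<open>h\<close> is
  constant on congruence classes and separates them, so it descends to the quotient
  injectively.\<close>

lemma max_group_image_is_iso:
  assumes closed_h: "\<And>s. s \<in> carrier S \<Longrightarrow> h s \<in> carrier G"
    and mult_h: "\<And>s t. \<lbrakk>s \<in> carrier S; t \<in> carrier S\<rbrakk> \<Longrightarrow> h (s \<cdot> t) = h s \<otimes>\<^bsub>G\<^esub> h t"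
    and surj_h: "\<And>g. g \<in> carrier G \<Longrightarrow> \<exists>s\<in>carrier S. h s = g"
    and ker_h: "\<And>s t. \<lbrakk>s \<in> carrier S; t \<in> carrier S\<rbrakk>
                  \<Longrightarrow> h s = h t \<longleftrightarrow> (s, t) \<in> min_group_cong S"
  shows "max_group_image S \<cong> G"
proof -
  let ?c = "\<lambda>s. min_group_cong S `` {s}"
  \<comment> \<open>The image of a class under \<open>h\<close> is a singleton, so the induced map
    needs no choice of representatives.\<close>
  let ?f = "\<lambda>A. the_elem (h ` A)"
  have car: "carrier (max_group_image S) = ?c ` carrier S"
    by (auto simp: max_group_image_def quotient_def)
  have f: "?f (?c s) = h s" if s: "s \<in> carrier S" for s
  proof -
    have "h ` ?c s = {h s}"
    proof (intro equalityI subsetI)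
      fix y assume "y \<in> h ` ?c s"
      then obtain t where "y = h t" "(s, t) \<in> min_group_cong S" by auto
      then show "y \<in> {h s}" using ker_h[OF s, of t] by (auto simp: mgc_iff)
    qed (use equiv_class_self[OF equiv_mgc s] in auto)
    then show ?thesis by simp
  qed
  have "?f \<in> hom (max_group_image S) G"
    by (rule homI) (auto simp: car f closed_h mult_h max_group_image_mult_class closed)
  moreover have "bij_betw ?f (carrier (max_group_image S)) (carrier G)"
  proof (rule bij_betw_imageI)
    show "inj_on ?f (carrier (max_group_image S))"
    proof (rule inj_onI)
      fix A B assume "A \<in> carrier (max_group_image S)" "B \<in> carrier (max_group_image S)"
        and eq: "?f A = ?f B"
      then obtain s t where st: "s \<in> carrier S" "t \<in> carrier S" "A = ?c s" "B = ?c t"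
        unfolding car by blast
      with eq have "(s, t) \<in> min_group_cong S" by (simp add: f ker_h)
      then show "A = B" using st equiv_class_eq[OF equiv_mgc] by simp
    qed
    show "?f ` carrier (max_group_image S) = carrier G"
      using closed_h surj_h by (force simp: car f image_image)
  qed
  ultimately show ?thesis by (auto simp: is_iso_def iso_def)
qed

end

section \<open>Moving idempotents across the Morita context\<close>

context morita_context
begin

lemma lip_closed: "\<lbrakk>x \<in> X; y \<in> X\<rbrakk> \<Longrightarrow> lip x y \<in> carrier S"
  using lip_surj by blast

lemma rip_closed: "\<lbrakk>x \<in> X; y \<in> X\<rbrakk> \<Longrightarrow> rip x y \<in> carrier T"
  using rip_surj by blast

lemma lip_idem: "x \<in> X \<Longrightarrow> lip x x \<in> idems S"
  using lip_lact[of "lip x x" x x] by (simp add: idems_def lip_closed lip_self)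

lemma rip_idem: "x \<in> X \<Longrightarrow> rip x x \<in> idems T"
  using rip_ract[of x x "rip x x"] by (simp add: idems_def rip_closed rip_self)

text \<open>Turns a left action by an idempotent of \<open>S\<close> into a right action by one of
  \<open>T\<close>. Idempotents commute, so ex = e\<langle>x, x\<rangle>x = \<langle>x, x\<rangle>ex
  = x[x, ex].\<close>

lemma rip_lact_idem:
  assumes x: "x \<in> X" and e: "e \<in> idems S"
  shows "lact e x = ract x (rip x (lact e x))" "rip x (lact e x) \<in> idems T"
proof -
  note c = x S.idemsD[OF e] lip_closed rip_closed lact_closed
  have "lact e x = lact (e \<cdot>\<^bsub>S\<^esub> lip x x) x" by (simp add: c lact_mult lip_self)
  also have "\<dots> = lact (lip x x \<cdot>\<^bsub>S\<^esub> e) x"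
    using S.idem_commute[OF e lip_idem[OF x]] by simp
  also have "\<dots> = ract x (rip x (lact e x))" by (simp add: c lact_mult lip_rip)
  finally show eq: "lact e x = ract x (rip x (lact e x))" .
  have ee: "lact e (lact e x) = lact e x"
    using lact_mult[of e e x] by (simp add: c)
  \<comment> \<open>Since the actions commute, the second factor slides past \<open>e\<close>, where
    x[x, ex] is ex again; then \<open>ee\<close> absorbs the repeated \<open>e\<close>.\<close>
  have "rip x (lact e x) \<cdot>\<^bsub>T\<^esub> rip x (lact e x) = rip x (ract (lact e x) (rip x (lact e x)))"
    by (simp add: c rip_ract)
  also have "\<dots> = rip x (lact e (ract x (rip x (lact e x))))"
    by (simp add: c lact_ract)
  also have "\<dots> = rip x (lact e x)" by (simp only: eq[symmetric] ee)
  finally show "rip x (lact e x) \<in> idems T" by (simp add: idems_def c)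
qed

text \<open>Squaring gives \<langle>\<langle>xe, x\<rangle>xe, x\<rangle>, and \<langle>xe,
  x\<rangle>xe = xe[x, x]e = x[x, x]e = xe because \<open>e\<close> commutes with [x, x].\<close>

lemma lip_ract_idem:
  assumes x: "x \<in> X" and e: "e \<in> idems T"
  shows "lip (ract x e) x \<in> idems S"
proof -
  note c = x T.idemsD[OF e] lip_closed rip_closed ract_closed T.closed
  have "lip (ract x e) x \<cdot>\<^bsub>S\<^esub> lip (ract x e) x = lip (lact (lip (ract x e) x) (ract x e)) x"
    by (simp add: c lip_lact)
  also have "lact (lip (ract x e) x) (ract x e) = ract x (e \<cdot>\<^bsub>T\<^esub> (rip x x \<cdot>\<^bsub>T\<^esub> e))"
    by (simp add: c lip_rip rip_ract ract_mult)
  also have "e \<cdot>\<^bsub>T\<^esub> (rip x x \<cdot>\<^bsub>T\<^esub> e) = rip x x \<cdot>\<^bsub>T\<^esub> e"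
    using T.idem_commute[OF e rip_idem[OF x]] T.idem_absorb[OF e, of "rip x x"] by (simp add: c)
  also have "ract x (rip x x \<cdot>\<^bsub>T\<^esub> e) = ract x e" by (simp add: c ract_mult rip_self)
  finally show ?thesis by (simp add: idems_def c)
qed

text \<open>Rewritten as a right action, the idempotent commutes with \<open>s\<close> and leaves
  the bracket as a right factor, which the congruence ignores.\<close>

lemma rip_lact_insert_idem:
  assumes p: "p \<in> X" and x: "x \<in> X" and s: "s \<in> carrier S" and e: "e \<in> idems S"
  shows "(rip p (lact s (lact e x)), rip p (lact s x)) \<in> min_group_cong T"
proof -
  let ?f = "rip x (lact e x)"
  note f = rip_lact_idem[OF x e]
  have "lact s (lact e x) = ract (lact s x) ?f"
    using f T.idemsD(1)[OF f(2)] by (simp add: lact_ract[OF s x])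
  then have "rip p (lact s (lact e x)) = rip p (lact s x) \<cdot>\<^bsub>T\<^esub> ?f"
    using T.idemsD(1)[OF f(2)] by (simp add: rip_ract p lact_closed s x)
  then show ?thesis
    using T.mgc_idem_right[OF f(2)] by (simp add: rip_closed lact_closed p s x)
qed

lemma rip_lact_idem_mgc:
  assumes p: "p \<in> X" and x: "x \<in> X" and e: "e \<in> idems S"
  shows "(rip p (lact e x), rip p x) \<in> min_group_cong T"
proof -
  note f = rip_lact_idem[OF x e]
  have "rip p (lact e x) = rip p x \<cdot>\<^bsub>T\<^esub> rip x (lact e x)"
    using f(1) T.idemsD(1)[OF f(2)] rip_ract[OF p x] by metis
  then show ?thesis using T.mgc_idem_right[OF f(2)] by (simp add: rip_closed p x)
qed

lemma rip_mult_mgc: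
  assumes p: "p \<in> X" and s: "s \<in> carrier S" and t: "t \<in> carrier S"
  shows "(rip p (lact (s \<cdot>\<^bsub>S\<^esub> t) p), rip p (lact s p) \<cdot>\<^bsub>T\<^esub> rip p (lact t p)) \<in> min_group_cong T"
proof -
  note c = p s t lip_closed rip_closed lact_closed S.closed
  have "rip p (lact s p) \<cdot>\<^bsub>T\<^esub> rip p (lact t p) = rip p (lact (lip (lact s p) p) (lact t p))"
    by (simp add: c rip_ract lip_rip)
  also have "lact (lip (lact s p) p) (lact t p) = lact s (lact (lip p p) (lact t p))"
    by (simp add: c lip_lact lact_mult)
  finally show ?thesis
    \<comment> \<open>The product of brackets differs from the bracket of the product only by
      \<langle>p, p\<rangle> inserted between \<open>s\<close> and \<open>t\<close>.\<close>
    using rip_lact_insert_idem[OF p _ s lip_idem[OF p], of "lact t p"]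
    by (simp add: c lact_mult T.mgc_sym)
qed

lemma rip_mgc_iff:
  assumes p: "p \<in> X" and s: "s \<in> carrier S" and t: "t \<in> carrier S"
  shows "(rip p (lact s p), rip p (lact t p)) \<in> min_group_cong T \<longleftrightarrow> (s, t) \<in> min_group_cong S"
proof
  assume "(s, t) \<in> min_group_cong S"
  then obtain e f where ef: "e \<in> idems S" "f \<in> idems S" "e \<cdot>\<^bsub>S\<^esub> s = f \<cdot>\<^bsub>S\<^esub> t"
    by (auto simp: S.mgc_iff)
  then have eq: "lact e (lact s p) = lact f (lact t p)"
    using p s t by (metis S.idemsD(1) lact_mult)
  have "(rip p (lact s p), rip p (lact e (lact s p))) \<in> min_group_cong T"
    using rip_lact_idem_mgc[OF p _ ef(1)] p s by (simp add: T.mgc_sym lact_closed)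
  also have "(rip p (lact e (lact s p)), rip p (lact t p)) \<in> min_group_cong T"
    unfolding eq using rip_lact_idem_mgc[OF p _ ef(2)] p t by (simp add: lact_closed)
  finally show "(rip p (lact s p), rip p (lact t p)) \<in> min_group_cong T" .
next
  assume "(rip p (lact s p), rip p (lact t p)) \<in> min_group_cong T"
  then obtain e f where ef: "e \<in> idems T" "f \<in> idems T"
      "e \<cdot>\<^bsub>T\<^esub> rip p (lact s p) = f \<cdot>\<^bsub>T\<^esub> rip p (lact t p)"
    by (auto simp: T.mgc_iff)
  \<comment> \<open>The reverse map recovers \<open>u\<close> despite the factor \<open>g\<close>:
    its value is \<langle>pg, p\<rangle>u\<langle>p, p\<rangle>, with idempotents on both sides of
    \<open>u\<close>.\<close>
  have lip_mgc: "(lip (ract p (g \<cdot>\<^bsub>T\<^esub> rip p (lact u p))) p, u) \<in> min_group_cong S"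
    if g: "g \<in> idems T" and u: "u \<in> carrier S" for g u
  proof -
    note c = p u T.idemsD(1)[OF g] lip_closed rip_closed lact_closed ract_closed S.closed
    have "ract p (g \<cdot>\<^bsub>T\<^esub> rip p (lact u p)) = lact (lip (ract p g) p) (lact u p)"
      by (simp add: c ract_mult lip_rip)
    then have eq: "lip (ract p (g \<cdot>\<^bsub>T\<^esub> rip p (lact u p))) p
        = lip (ract p g) p \<cdot>\<^bsub>S\<^esub> (u \<cdot>\<^bsub>S\<^esub> lip p p)"
      by (simp add: c lip_lact)
    have "(lip (ract p g) p \<cdot>\<^bsub>S\<^esub> (u \<cdot>\<^bsub>S\<^esub> lip p p), u \<cdot>\<^bsub>S\<^esub> lip p p) \<in> min_group_cong S"
      by (rule S.mgc_idem_left[OF lip_ract_idem[OF p g]]) (simp add: c)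
    also have "(u \<cdot>\<^bsub>S\<^esub> lip p p, u) \<in> min_group_cong S"
      by (rule S.mgc_idem_right[OF lip_idem[OF p] u])
    finally show "(lip (ract p (g \<cdot>\<^bsub>T\<^esub> rip p (lact u p))) p, u) \<in> min_group_cong S"
      unfolding eq .
  qed
  show "(s, t) \<in> min_group_cong S"
    using S.mgc_trans[OF S.mgc_sym[OF lip_mgc[OF ef(1) s]]] lip_mgc[OF ef(2) t] ef(3) by simp
qed

text \<open>Provides surjectivity: \<langle>pt, p\<rangle>p = pt[p, p], so the bracket is
  \<open>t\<close> between two copies of the idempotent [p, p].\<close>

lemma rip_lip_mgc:
  assumes p: "p \<in> X" and t: "t \<in> carrier T"
  shows "(rip p (lact (lip (ract p t) p) p), t) \<in> min_group_cong T"
proof -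
  note c = p t rip_closed ract_closed T.closed
  have "rip p (lact (lip (ract p t) p) p) = rip p p \<cdot>\<^bsub>T\<^esub> t \<cdot>\<^bsub>T\<^esub> rip p p"
    by (simp add: c lip_rip rip_ract)
  also have "(\<dots>, rip p p \<cdot>\<^bsub>T\<^esub> t) \<in> min_group_cong T"
    by (rule T.mgc_idem_right[OF rip_idem[OF p]]) (simp add: c)
  also have "(rip p p \<cdot>\<^bsub>T\<^esub> t, t) \<in> min_group_cong T"
    by (rule T.mgc_idem_left[OF rip_idem[OF p] t])
  finally show ?thesis .
qed

lemma max_group_image_iso: "max_group_image S \<cong> max_group_image T"
proof (cases "X = {}")
  case True
  \<comment> \<open>There is no base point here; both quotients have empty carriers, so the
    conditions of the isomorphism criterion hold vacuously.\<close>
  then have "carrier S = {}" "carrier T = {}" using lip_surj rip_surj by auto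
  then show ?thesis
    by (intro S.max_group_image_is_iso) (simp_all add: max_group_image_def)
next
  case False
  then obtain p where p: "p \<in> X" by blast
  let ?c = "\<lambda>t. min_group_cong T `` {t}"
  have car: "carrier (max_group_image T) = ?c ` carrier T"
    by (auto simp: max_group_image_def quotient_def)
  have r: "rip p (lact s p) \<in> carrier T" if "s \<in> carrier S" for s
    using that p by (simp add: rip_closed lact_closed)
  show ?thesis
  proof (rule S.max_group_image_is_iso[where h = "\<lambda>s. ?c (rip p (lact s p))"])
    fix s assume "s \<in> carrier S"
    then show "?c (rip p (lact s p)) \<in> carrier (max_group_image T)" by (simp add: car r)
  next
    fix s t assume st: "s \<in> carrier S" "t \<in> carrier S"
    then show "?c (rip p (lact (s \<cdot>\<^bsub>S\<^esub> t) p))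
        = ?c (rip p (lact s p)) \<otimes>\<^bsub>max_group_image T\<^esub> ?c (rip p (lact t p))"
      by (simp add: r T.max_group_image_mult_class
          equiv_class_eq[OF T.equiv_mgc rip_mult_mgc[OF p]])
    show "?c (rip p (lact s p)) = ?c (rip p (lact t p)) \<longleftrightarrow> (s, t) \<in> min_group_cong S"
      using st eq_equiv_class_iff[OF T.equiv_mgc r r] rip_mgc_iff[OF p] by simp
  next
    fix g assume "g \<in> carrier (max_group_image T)"
    then obtain t where t: "t \<in> carrier T" "g = ?c t" by (auto simp: car)
    then have "?c (rip p (lact (lip (ract p t) p) p)) = g"
      using equiv_class_eq[OF T.equiv_mgc rip_lip_mgc[OF p]] by simp
    \<comment> \<open>The witness is \<langle>pt, p\<rangle>.\<close>
    then show "\<exists>s\<in>carrier S. ?c (rip p (lact s p)) = g"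
      using p t by (auto intro: lip_closed ract_closed)
  qed
qed

end

theorem corollary5p14:
  fixes S :: "'a sgrp" and T :: "'b sgrp"
  assumes "inverse_semigroup S" and "inverse_semigroup T"
    and "strongly_morita_equivalent TYPE('x) S T"
  shows "max_group_image S \<cong> max_group_image T"
  using assms(3) morita_context.max_group_image_iso
  unfolding strongly_morita_equivalent_def by blast

end
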